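(* Consider a country with a finite set of voters $H$, a finite set of political parties $T$, and a finite nonempty set of elections $L$. Each voter $h\in H$ has a fixed probability $p_h\in[0,1]$ of voting on any poll date and always votes for the same party $t(h)\in T$. Suppose that: (a) each election can be won by at most one party; and (b) for any turnout in any election, an extra vote for some party can neither decrease that party's win probability nor increase the win probability of a rival party. Let $\Pi$ and $\Pi'$ be two staggered polling schedules such that $\Pi$ is coarser than $\Pi'$, i.e. for every voter $h$, any two elections that are simultaneous for $h$ in $\Pi'$ are also simultaneous for $h$ in $\Pi$. Then for every party $s\in T$, the probability that $s$ wins all the elections under schedule $\Pi$ is greater than or equal to the probability that $s$ wins all the elections under schedule $\Pi'$.
   Context: A staggered polling schedule is a family $\Pi=(\pi_h)_{h\in H}$ where each $\pi_h$ is a partition of $L$; two elections are simultaneous for voter $h$ (held for $h$ on the same poll date) if they lie in the same part of $\pi_h$. Turnout: given $\Pi$, for each voter $h$ and each part $M\in\pi_h$ (a poll date for $h$), $h$ turns out on that date with probability $p_h$, independently over all pairs $(h,M)$ with $h\in H$, $M\in\pi_h$. If $h$ turns out on date $M$, then $h$ casts a vote for party $t(h)$ in every election $l\in M$; otherwise $h$ votes in no election $l\in M$. For $l\in L$ let $S_l\subseteq H$ be the (random) set of voters who vote in election $l$. Election outcomes: for each $l\in L$, $s\in T$ and $S\subseteq H$, let $f_{l,s}(S)\in[0,1]$ be the probability that party $s$ wins election $l$ when $S$ is the set of voters who voted in it (the outcome may be random, e.g. because ties are decided by coin tosses; it may also depend on the identities of the voters in $S$, and there may be no winner). Conditional on the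 sets $(S_l)_{l\in L}$, the outcomes of the different elections are independent. Condition (a) says that in each election at most one party wins, so $\sum_{s\in T} f_{l,s}(S)\le 1$. Condition (b) says that for all $l\in L$, $S\subseteq H$ and $h\in H$: $f_{l,t(h)}(S\cup\{h\})\ge f_{l,t(h)}(S)$, and $f_{l,s}(S\cup\{h\})\le f_{l,s}(S)$ for every $s\ne t(h)$. Thus the probability that party $s$ wins all the elections under a given schedule is $\mathbb{E}\big[\prod_{l\in L} f_{l,s}(S_l)\big]$. *)

theory Defs
  imports "HOL-Probability.Probability" "HOL-Library.Disjoint_Sets"
begin

definition polling_schedule :: "'h set \<Rightarrow> 'l set \<Rightarrow> ('h \<Rightarrow> 'l set set) \<Rightarrow> bool" where
  "polling_schedule H L P \<longleftrightarrow> (\<forall>h\<in>H. partition_on L (P h))"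

definition simultaneous :: "('h \<Rightarrow> 'l set set) \<Rightarrow> 'h \<Rightarrow> 'l \<Rightarrow> 'l \<Rightarrow> bool" where
  "simultaneous P h l l' \<longleftrightarrow> (\<exists>M\<in>P h. l \<in> M \<and> l' \<in> M)"

definition coarser :: "'h set \<Rightarrow> 'l set \<Rightarrow> ('h \<Rightarrow> 'l set set) \<Rightarrow> ('h \<Rightarrow> 'l set set) \<Rightarrow> bool" where
  "coarser H L P P' \<longleftrightarrow>
     (\<forall>h\<in>H. \<forall>l\<in>L. \<forall>l'\<in>L. simultaneous P' h l l' \<longrightarrow> simultaneous P h l l')"

(* A sample point tells, for each voter h and each poll date M of h, whether h turns out. *)
definition turnout_pmf ::
  "'h set \<Rightarrow> ('h \<Rightarrow> real) \<Rightarrow> ('h \<Rightarrow> 'l set set) \<Rightarrow> ('h \<times> 'l set \<Rightarrow> bool) pmf" where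
  "turnout_pmf H p P = Pi_pmf (SIGMA h:H. P h) False (\<lambda>(h, M). bernoulli_pmf (p h))"

definition voters_in ::
  "'h set \<Rightarrow> ('h \<Rightarrow> 'l set set) \<Rightarrow> ('h \<times> 'l set \<Rightarrow> bool) \<Rightarrow> 'l \<Rightarrow> 'h set" where
  "voters_in H P X l = {h \<in> H. \<exists>M\<in>P h. l \<in> M \<and> X (h, M)}"

text \<open>
  The random outcome of election \<open>l\<close>, given that \<open>S\<close> is the set of those who voted in it, is
  the set of parties that win it, with distribution \<open>R l S\<close>. That at most one party wins is a
  hypothesis on \<open>R\<close> and not part of its type.
\<close>

definition win_prob :: "('l \<Rightarrow> 'h set \<Rightarrow> 't set pmf) \<Rightarrow> 'l \<Rightarrow> 't \<Rightarrow> 'h set \<Rightarrow> real" where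
  "win_prob R l s S = measure_pmf.prob (R l S) {W. s \<in> W}"

definition at_most_one_winner ::
  "'h set \<Rightarrow> 't set \<Rightarrow> 'l set \<Rightarrow> ('l \<Rightarrow> 'h set \<Rightarrow> 't set pmf) \<Rightarrow> bool" where
  "at_most_one_winner H T L R \<longleftrightarrow>
     (\<forall>l\<in>L. \<forall>S. S \<subseteq> H \<longrightarrow> (\<forall>W\<in>set_pmf (R l S). W \<subseteq> T \<and> card W \<le> 1))"

definition extra_vote_monotone ::
  "'h set \<Rightarrow> 't set \<Rightarrow> 'l set \<Rightarrow> ('h \<Rightarrow> 't) \<Rightarrow> ('l \<Rightarrow> 'h set \<Rightarrow> 't set pmf) \<Rightarrow> bool" where
  "extra_vote_monotone H T L t R \<longleftrightarrow>
     (\<forall>l\<in>L. \<forall>S. S \<subseteq> H \<longrightarrow> (\<forall>h\<in>H.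
        win_prob R l (t h) (insert h S) \<ge> win_prob R l (t h) S \<and>
        (\<forall>s\<in>T. s \<noteq> t h \<longrightarrow> win_prob R l s (insert h S) \<le> win_prob R l s S)))"

text \<open>
  The joint distribution of the outcomes of all elections: given the turnout, hence the sets of
  voters in the elections, the outcomes of different elections are independent.
\<close>

definition outcome_pmf ::
  "'h set \<Rightarrow> 'l set \<Rightarrow> ('h \<Rightarrow> real) \<Rightarrow> ('l \<Rightarrow> 'h set \<Rightarrow> 't set pmf) \<Rightarrow> ('h \<Rightarrow> 'l set set)
     \<Rightarrow> ('l \<Rightarrow> 't set) pmf" where
  "outcome_pmf H L p R P =
     bind_pmf (turnout_pmf H p P) (\<lambda>X. Pi_pmf L {} (\<lambda>l. R l (voters_in H P X l)))"

definition win_all_prob ::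
  "'h set \<Rightarrow> 'l set \<Rightarrow> ('h \<Rightarrow> real) \<Rightarrow> ('l \<Rightarrow> 'h set \<Rightarrow> 't set pmf) \<Rightarrow> ('h \<Rightarrow> 'l set set)
     \<Rightarrow> 't \<Rightarrow> real" where
  "win_all_prob H L p R P s = measure_pmf.prob (outcome_pmf H L p R P) {W. \<forall>l\<in>L. s \<in> W l}"

lemma win_all_prob_eq_expectation:
  assumes "finite L"
  shows "win_all_prob H L p R P s =
    measure_pmf.expectation (turnout_pmf H p P)
      (\<lambda>X. \<Prod>l\<in>L. win_prob R l s (voters_in H P X l))"
proof -
  have prod: "measure_pmf.prob (Pi_pmf L {} (\<lambda>l. R l (V l))) {W. \<forall>l\<in>L. s \<in> W l} =
      (\<Prod>l\<in>L. win_prob R l s (V l))" for V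
    using measure_Pi_pmf_Pi[OF assms, where dflt = "{}" and p = "\<lambda>l. R l (V l)"
        and B = "\<lambda>_. {W. s \<in> W}"]
    by (simp add: win_prob_def Pi_def Ball_def)
  show ?thesis
    unfolding win_all_prob_def outcome_pmf_def measure_pmf_bind
    by (subst measure_pmf.measure_bind[where N = "count_space UNIV"]) (simp_all add: prod Pi_iff measure_pmf_in_subprob_space)
qed

lemma sum_win_prob_le_1:
  assumes "finite T" "at_most_one_winner H T L R" "l \<in> L" "S \<subseteq> H"
  shows "(\<Sum>s\<in>T. win_prob R l s S) \<le> 1"
proof -
  have "(\<Sum>s\<in>T. win_prob R l s S) = (\<Sum>s\<in>T. measure_pmf.prob (R l S) ({W. s \<in> W} \<inter> set_pmf (R l S)))"
    by (simp add: win_prob_def measure_Int_set_pmf)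
  also have "\<dots> = measure_pmf.prob (R l S) (\<Union>s\<in>T. {W. s \<in> W} \<inter> set_pmf (R l S))"
  proof (rule measure_pmf.finite_measure_finite_Union [symmetric])
    have "r = s" if "W \<in> set_pmf (R l S)" "r \<in> W" "s \<in> W" for r s W
    proof -
      have "W \<subseteq> T" "card W \<le> 1" using assms that by (auto simp: at_most_one_winner_def)
      moreover have "finite W" using \<open>W \<subseteq> T\<close> assms(1) finite_subset by blast
      ultimately show ?thesis using that card_le_Suc0_iff_eq[of W] by auto
    qed
    then show "disjoint_family_on (\<lambda>s. {W. s \<in> W} \<inter> set_pmf (R l S)) T"
      by (fastforce simp: disjoint_family_on_def)
  qed (use assms in auto)
  also have "\<dots> \<le> 1" by simp
  finally show ?thesis .
qed

text \<open>Conversely, all win probabilities with sum at most 1 arise from some \<open>R\<close>.\<close>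

lemma ex_at_most_one_winner:
  fixes f :: "'l \<Rightarrow> 't \<Rightarrow> 'h set \<Rightarrow> real"
  assumes "finite T"
    and nonneg: "\<And>l s S. l \<in> L \<Longrightarrow> s \<in> T \<Longrightarrow> S \<subseteq> H \<Longrightarrow> 0 \<le> f l s S"
    and sum: "\<And>l S. l \<in> L \<Longrightarrow> S \<subseteq> H \<Longrightarrow> (\<Sum>s\<in>T. f l s S) \<le> 1"
  shows "\<exists>R. at_most_one_winner H T L R \<and>
    (\<forall>l\<in>L. \<forall>s\<in>T. \<forall>S. S \<subseteq> H \<longrightarrow> win_prob R l s S = f l s S)"
proof -
  have "\<exists>q. (\<forall>W\<in>set_pmf q. W \<subseteq> T \<and> card W \<le> 1) \<and>
      (\<forall>s\<in>T. measure_pmf.prob q {W. s \<in> W} = f l s S)" if "l \<in> L" "S \<subseteq> H" for l S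
  proof -
    define g where "g W = (if W = {} then 1 - (\<Sum>s\<in>T. f l s S)
      else if W \<in> (\<lambda>s. {s}) ` T then f l (the_elem W) S else 0)" for W
    let ?A = "insert {} ((\<lambda>s. {s}) ` T)"
    have fin: "finite ?A" using assms(1) by simp
    have g_nonneg: "0 \<le> g W" for W
      using nonneg sum that by (auto simp: g_def)
    have supp: "{W. g W \<noteq> 0} \<subseteq> ?A"
      by (auto simp: g_def split: if_splits)
    have "(\<Sum>W\<in>(\<lambda>s. {s}) ` T. g W) = (\<Sum>s\<in>T. f l s S)"
      by (subst sum.reindex) (auto simp: g_def)
    then have "(\<Sum>W\<in>?A. g W) = 1"
      using assms(1) by (subst sum.insert) (auto simp: g_def)
    moreover have "(\<integral>\<^sup>+ W. ennreal (g W) \<partial>count_space UNIV) = (\<Sum>W\<in>?A. ennreal (g W))"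
    proof (rule nn_integral_count_space'[OF fin])
      show "ennreal (g W) = 0" if "W \<notin> ?A" for W
      proof -
        have "g W = 0" using that supp by blast
        then show ?thesis by simp
      qed
    qed simp
    ultimately have total: "(\<integral>\<^sup>+ W. ennreal (g W) \<partial>count_space UNIV) = 1"
      using g_nonneg by (simp only: sum_ennreal ennreal_1)
    have pmf_q: "pmf (embed_pmf g) W = g W" for W
      by (rule pmf_embed_pmf[OF g_nonneg total])
    have set_q: "set_pmf (embed_pmf g) \<subseteq> ?A"
      using supp by (auto simp: set_pmf_eq pmf_q)
    have "measure_pmf.prob (embed_pmf g) {W. s \<in> W} = f l s S" if "s \<in> T" for s
    proof -
      have "measure_pmf.prob (embed_pmf g) {W. s \<in> W} = measure_pmf.prob (embed_pmf g) {{s}}"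
        using set_q by (intro measure_pmf.finite_measure_eq_AE) (auto simp: AE_measure_pmf_iff)
      also have "\<dots> = f l s S"
        using that by (simp add: measure_pmf_single pmf_q g_def)
      finally show ?thesis .
    qed
    moreover have "W \<subseteq> T \<and> card W \<le> 1" if "W \<in> set_pmf (embed_pmf g)" for W
      using that set_q by auto
    ultimately show ?thesis by blast
  qed
  then obtain q where q: "\<And>l S. l \<in> L \<Longrightarrow> S \<subseteq> H \<Longrightarrow> (\<forall>W\<in>set_pmf (q l S). W \<subseteq> T \<and> card W \<le> 1) \<and>
      (\<forall>s\<in>T. measure_pmf.prob (q l S) {W. s \<in> W} = f l s S)"
    by metis
  then show ?thesis
    by (intro exI[of _ q]) (auto simp: at_most_one_winner_def win_prob_def)
qed

end

theory Submission
  imports Defs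
begin

text \<open>
  Give up the staggering voter by voter. Fix one voter \<open>h\<close> and condition on the votes of everybody
  else. In each election \<open>l\<close> the party \<open>s\<close> then wins with probability \<open>u l\<close> if \<open>h\<close> votes and
  \<open>v l\<close> if not, and the chance of winning all elections factorises over the poll dates of \<open>h\<close>,
  which are independent coins: a date \<open>M\<close> contributes
  \<open>q (\<Prod>l\<in>M. u l) + (1 - q) (\<Prod>l\<in>M. v l)\<close> (\<open>coin_mean\<close>). If \<open>h\<close> supports \<open>s\<close> then
  \<open>v \<le> u\<close> throughout, and otherwise \<open>u \<le> v\<close> throughout. In both cases, wins on
  different dates become nonnegatively correlated once a common coin decides the dates, so merging
  dates can only help (\<open>coin_mean_Un_ge\<close>, extended to arbitrary coarsenings of a partition in
  \<open>prod_coin_mean_mono_coarser\<close>).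

  To exchange the schedules one voter at a time, the turnout is rewritten as a product over voters
  only, the factor of a voter being the distribution of the set of elections in which she votes
  (\<open>ballot_pmf\<close>, \<open>win_all_prob_eq_nn_integral\<close>). Then \<open>nn_integral_Pi_pmf_mono\<close> reduces the
  comparison of the two products to the comparison for a single voter.
\<close>

section \<open>Finite products of discrete distributions\<close>

text \<open>
  \<^const>\<open>case_prod\<close> is a bijection between curried and uncurried functions, so it suffices to
  compare point masses. The inner default \<open>d\<close> forces the outer default to be constantly \<open>d\<close>.
\<close>

lemma Pi_pmf_Sigma:
  assumes "finite A" and "\<And>x. x \<in> A \<Longrightarrow> finite (B x)"
  shows "Pi_pmf (SIGMA x:A. B x) d p =
    map_pmf case_prod (Pi_pmf A (\<lambda>_. d) (\<lambda>x. Pi_pmf (B x) d (\<lambda>y. p (x, y))))"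
    (is "?lhs = map_pmf _ ?nested")
proof (rule pmf_eqI)
  fix f :: "'a \<times> 'b \<Rightarrow> 'c"
  have "inj (case_prod :: ('a \<Rightarrow> 'b \<Rightarrow> 'c) \<Rightarrow> _)"
    by (rule injI) (metis curry_case_prod)
  then have "pmf (map_pmf case_prod ?nested) (case_prod (curry f)) = pmf ?nested (curry f)"
    by (rule pmf_map_inj')
  then have map: "pmf (map_pmf case_prod ?nested) f = pmf ?nested (curry f)"
    by simp
  have fin: "finite (SIGMA x:A. B x)"
    using assms by (rule finite_SigmaI)
  show "pmf ?lhs f = pmf (map_pmf case_prod ?nested) f"
  proof (cases "\<forall>z. z \<notin> (SIGMA x:A. B x) \<longrightarrow> f z = d")
    case True
    have "pmf ?lhs f = (\<Prod>(x, y)\<in>(SIGMA x:A. B x). pmf (p (x, y)) (f (x, y)))"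
      using True fin by (simp add: pmf_Pi case_prod_unfold)
    also have "\<dots> = (\<Prod>x\<in>A. \<Prod>y\<in>B x. pmf (p (x, y)) (f (x, y)))"
      using assms by (simp add: prod.Sigma)
    also have "\<dots> = (\<Prod>x\<in>A. pmf (Pi_pmf (B x) d (\<lambda>y. p (x, y))) (curry f x))"
      using True assms(2) by (intro prod.cong refl) (simp add: pmf_Pi)
    also have "\<dots> = pmf ?nested (curry f)"
      using True assms(1) by (subst pmf_Pi) (auto simp: fun_eq_iff)
    finally show ?thesis
      by (simp add: map)
  next
    case False
    then obtain x y where xy: "(x, y) \<notin> (SIGMA x:A. B x)" "f (x, y) \<noteq> d"
      by auto
    have "pmf ?nested (curry f) = 0"
    proof (cases "x \<in> A")
      case True
      then have "pmf (Pi_pmf (B x) d (\<lambda>y. p (x, y))) (curry f x) = 0"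
        using xy assms(2) by (intro pmf_Pi_outside) auto
      then have "(\<Prod>x\<in>A. pmf (Pi_pmf (B x) d (\<lambda>y. p (x, y))) (curry f x)) = 0"
        using True assms(1) by (intro prod_zero) auto
      then show ?thesis
        using assms(1) by (simp add: pmf_Pi)
    next
      case False
      then show ?thesis
        using xy assms(1) by (intro pmf_Pi_outside) (auto simp: fun_eq_iff)
    qed
    moreover have "pmf ?lhs f = 0"
      using xy fin by (intro pmf_Pi_outside) auto
    ultimately show ?thesis
      by (simp add: map)
  qed
qed

lemma nn_integral_Pi_pmf_insert:
  assumes "finite A" "x \<notin> A"
  shows "(\<integral>\<^sup>+ f. F f \<partial>Pi_pmf (insert x A) d p) =
      (\<integral>\<^sup>+ y. \<integral>\<^sup>+ f. F (f(x := y)) \<partial>Pi_pmf A d p \<partial>p x)"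
    and "(\<integral>\<^sup>+ f. F f \<partial>Pi_pmf (insert x A) d p) =
      (\<integral>\<^sup>+ f. \<integral>\<^sup>+ y. F (f(x := y)) \<partial>p x \<partial>Pi_pmf A d p)"
proof -
  show "(\<integral>\<^sup>+ f. F f \<partial>Pi_pmf (insert x A) d p) =
      (\<integral>\<^sup>+ y. \<integral>\<^sup>+ f. F (f(x := y)) \<partial>Pi_pmf A d p \<partial>p x)"
    using assms by (simp add: Pi_pmf_insert nn_integral_pair_pmf')
  show "(\<integral>\<^sup>+ f. F f \<partial>Pi_pmf (insert x A) d p) =
      (\<integral>\<^sup>+ f. \<integral>\<^sup>+ y. F (f(x := y)) \<partial>p x \<partial>Pi_pmf A d p)"
    using assms by (subst Pi_pmf_insert, simp, simp, subst pair_commute_pmf)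
      (simp add: nn_integral_pair_pmf')
qed

text \<open>
  The hybrid argument: if replacing any one factor raises the integral whatever the values of the
  other coordinates, then the factors can be replaced one after the other. Since \<open>F\<close> takes its
  values in \<^typ>\<open>ennreal\<close>, the order of integration never matters.
\<close>

lemma nn_integral_Pi_pmf_mono:
  assumes "finite A"
    and "\<And>x f. x \<in> A \<Longrightarrow>
      (\<integral>\<^sup>+ y. F (f(x := y)) \<partial>measure_pmf (p x)) \<le> (\<integral>\<^sup>+ y. F (f(x := y)) \<partial>measure_pmf (q x))"
  shows "(\<integral>\<^sup>+ f. F f \<partial>Pi_pmf A d p) \<le> (\<integral>\<^sup>+ f. F f \<partial>Pi_pmf A d q)"
  using assms
proof (induction A arbitrary: F rule: finite_induct)
  case empty
  then show ?case by simp
next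
  case (insert x A)
  have other: "Pi_pmf A d (p(x := q x)) = Pi_pmf A d p"
    using insert.hyps by (intro Pi_pmf_cong) auto
  have "(\<integral>\<^sup>+ f. F f \<partial>Pi_pmf (insert x A) d p) =
      (\<integral>\<^sup>+ f. \<integral>\<^sup>+ y. F (f(x := y)) \<partial>p x \<partial>Pi_pmf A d p)"
    using insert.hyps by (rule nn_integral_Pi_pmf_insert)
  also have "\<dots> \<le> (\<integral>\<^sup>+ f. \<integral>\<^sup>+ y. F (f(x := y)) \<partial>q x \<partial>Pi_pmf A d p)"
    by (intro nn_integral_mono insert.prems) simp
  \<comment> \<open>Both sides are the integral over the hybrid product in which only \<open>x\<close> has been switched.\<close>
  also have "\<dots> = (\<integral>\<^sup>+ y. \<integral>\<^sup>+ f. F (f(x := y)) \<partial>Pi_pmf A d p \<partial>q x)"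
    using nn_integral_Pi_pmf_insert[OF insert.hyps, where p = "p(x := q x)" and d = d and F = F]
    by (simp add: other)
  also have "\<dots> \<le> (\<integral>\<^sup>+ y. \<integral>\<^sup>+ f. F (f(x := y)) \<partial>Pi_pmf A d q \<partial>q x)"
  proof (intro nn_integral_mono insert.IH)
    fix y :: 'b and z and f :: "'a \<Rightarrow> 'b"
    assume "z \<in> A"
    then have "(f(z := w))(x := y) = (f(x := y))(z := w)" for w :: 'b
      using insert.hyps by (auto simp: fun_upd_twist)
    then show "(\<integral>\<^sup>+ w. F ((f(z := w))(x := y)) \<partial>p z) \<le> (\<integral>\<^sup>+ w. F ((f(z := w))(x := y)) \<partial>q z)"
      using insert.prems[of z "f(x := y)"] \<open>z \<in> A\<close> by (simp only: insertI2)
  qed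
  also have "\<dots> = (\<integral>\<^sup>+ f. F f \<partial>Pi_pmf (insert x A) d q)"
    using insert.hyps by (rule nn_integral_Pi_pmf_insert(1)[symmetric])
  finally show ?case .
qed

section \<open>Merging the poll dates of one voter\<close>

text \<open>
  If one coin with bias \<open>q\<close> decides for all \<open>l \<in> M\<close> simultaneously whether the factor is \<open>u l\<close> or
  \<open>v l\<close>, this is the expected product of the factors.
\<close>

definition coin_mean :: "real \<Rightarrow> ('l \<Rightarrow> real) \<Rightarrow> ('l \<Rightarrow> real) \<Rightarrow> 'l set \<Rightarrow> real" where
  "coin_mean q u v M = q * (\<Prod>l\<in>M. u l) + (1 - q) * (\<Prod>l\<in>M. v l)"

lemma coin_mean_nonneg:
  assumes "0 \<le> q" "q \<le> 1" "\<And>l. l \<in> M \<Longrightarrow> 0 \<le> u l" "\<And>l. l \<in> M \<Longrightarrow> 0 \<le> v l"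
  shows "0 \<le> coin_mean q u v M"
  using assms by (simp add: coin_mean_def prod_nonneg)

text \<open>
  Chebyshev's association inequality for a single coin: both products move in the same direction
  with the coin, so they are nonnegatively correlated. The difference of the two sides is
  \<open>q (1 - q)\<close> times the product of the two increments.
\<close>

lemma coin_mean_Un_ge:
  assumes "0 \<le> q" "q \<le> 1" and fin: "finite M" "finite N" and "M \<inter> N = {}"
    and nonneg: "\<And>l. l \<in> M \<union> N \<Longrightarrow> 0 \<le> u l \<and> 0 \<le> v l"
    and "(\<forall>l\<in>M \<union> N. v l \<le> u l) \<or> (\<forall>l\<in>M \<union> N. u l \<le> v l)"
  shows "coin_mean q u v M * coin_mean q u v N \<le> coin_mean q u v (M \<union> N)"
proof -
  let ?U = "prod u" and ?V = "prod v"
  have "(?V M \<le> ?U M \<and> ?V N \<le> ?U N) \<or> (?U M \<le> ?V M \<and> ?U N \<le> ?V N)"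
    using assms(7) by (elim disjE) (use nonneg in \<open>auto intro!: prod_mono\<close>)
  then have "0 \<le> (?U M - ?V M) * (?U N - ?V N)"
    by (auto simp: zero_le_mult_iff)
  then have "0 \<le> (q * (1 - q)) * ((?U M - ?V M) * (?U N - ?V N))"
    using assms(1,2) by (intro mult_nonneg_nonneg[of "q * (1 - q)"]) auto
  then show ?thesis
    using assms(5) fin by (simp add: coin_mean_def prod.union_disjoint algebra_simps)
qed

lemma prod_coin_mean_le_Union:
  assumes "0 \<le> q" "q \<le> 1" and "finite C" and "\<And>M. M \<in> C \<Longrightarrow> finite M" and "disjoint C"
    and "\<And>l. l \<in> \<Union>C \<Longrightarrow> 0 \<le> u l \<and> 0 \<le> v l"
    and "(\<forall>l\<in>\<Union>C. v l \<le> u l) \<or> (\<forall>l\<in>\<Union>C. u l \<le> v l)"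
  shows "(\<Prod>M\<in>C. coin_mean q u v M) \<le> coin_mean q u v (\<Union>C)"
  using assms(3-)
proof (induction C rule: finite_induct)
  case empty
  then show ?case by (simp add: coin_mean_def)
next
  case (insert M C)
  have disj: "M \<inter> \<Union>C = {}" "disjoint C"
    using insert.prems(2) insert.hyps by (auto simp: pairwise_insert) (auto simp: disjnt_def)
  have "(\<Prod>N\<in>C. coin_mean q u v N) \<le> coin_mean q u v (\<Union>C)"
    using insert.prems disj by (intro insert.IH) auto
  then have "(\<Prod>N\<in>insert M C. coin_mean q u v N) \<le> coin_mean q u v M * coin_mean q u v (\<Union>C)"
    using insert.hyps insert.prems(3) assms(1,2)
    by (auto intro!: mult_left_mono coin_mean_nonneg)
  also have "\<dots> \<le> coin_mean q u v (M \<union> \<Union>C)"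
    using insert.hyps insert.prems disj assms(1,2) by (intro coin_mean_Un_ge) auto
  finally show ?case by simp
qed

text \<open>
  Group the parts of the finer partition \<open>Q'\<close> by the part of \<open>Q\<close> that contains them. Each group
  is merged into one part without decreasing its contribution.
\<close>

lemma prod_coin_mean_mono_coarser:
  assumes "0 \<le> q" "q \<le> 1" "finite L"
    and Q: "partition_on L Q" and Q': "partition_on L Q'"
    and refine: "\<And>M'. M' \<in> Q' \<Longrightarrow> \<exists>M\<in>Q. M' \<subseteq> M"
    and nonneg: "\<And>l. l \<in> L \<Longrightarrow> 0 \<le> u l \<and> 0 \<le> v l"
    and mono: "(\<forall>l\<in>L. v l \<le> u l) \<or> (\<forall>l\<in>L. u l \<le> v l)"
  shows "(\<Prod>M\<in>Q'. coin_mean q u v M) \<le> (\<Prod>M\<in>Q. coin_mean q u v M)"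
proof -
  define C where "C M = {M' \<in> Q'. M' \<subseteq> M}" for M
  have finQ: "finite Q" "finite Q'"
    using finite_elements assms(3) Q Q' by auto
  have sub: "M \<subseteq> L" if "M \<in> Q \<union> Q'" for M
    using that Q Q' by (auto dest: partition_onD1)
  have disjQ: "M = N" if "M \<in> Q" "N \<in> Q" "l \<in> M" "l \<in> N" for M N l
    using that partition_onD2[OF Q] by (auto simp: disjoint_def)
  have Union: "\<Union>(C M) = M" if "M \<in> Q" for M
  proof
    show "M \<subseteq> \<Union>(C M)"
    proof
      fix l assume "l \<in> M"
      then have "l \<in> L" using sub that by auto
      then obtain M' where M': "M' \<in> Q'" "l \<in> M'"
        using Q' by (auto dest: partition_onD1)
      then obtain N where "N \<in> Q" "M' \<subseteq> N"
        using refine by blast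
      then have "N = M"
        using disjQ that M' \<open>l \<in> M\<close> by blast
      then show "l \<in> \<Union>(C M)"
        using M' \<open>M' \<subseteq> N\<close> by (auto simp: C_def)
    qed
  qed (auto simp: C_def)
  have "Q' = (\<Union>M\<in>Q. C M)"
    using refine by (auto simp: C_def)
  moreover have "C M \<inter> C N = {}" if "M \<in> Q" "N \<in> Q" "M \<noteq> N" for M N
  proof (rule ccontr)
    assume "C M \<inter> C N \<noteq> {}"
    then obtain M' where "M' \<in> Q'" "M' \<subseteq> M" "M' \<subseteq> N" by (auto simp: C_def)
    moreover have "M' \<noteq> {}" using \<open>M' \<in> Q'\<close> partition_onD3[OF Q'] by auto
    ultimately show False using disjQ that by blast
  qed
  ultimately have "(\<Prod>M\<in>Q'. coin_mean q u v M) = (\<Prod>M\<in>Q. \<Prod>M'\<in>C M. coin_mean q u v M')"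
    using finQ prod.UNION_disjoint[of Q C "coin_mean q u v"] by (auto simp: C_def)
  also have "\<dots> \<le> (\<Prod>M\<in>Q. coin_mean q u v M)"
  proof (rule prod_mono, intro conjI)
    fix M assume M: "M \<in> Q"
    have CL: "M' \<subseteq> L" if "M' \<in> C M" for M'
      using that sub by (auto simp: C_def)
    show "0 \<le> (\<Prod>M'\<in>C M. coin_mean q u v M')"
      using CL nonneg assms(1,2) by (intro prod_nonneg coin_mean_nonneg) blast+
    have "(\<Prod>M'\<in>C M. coin_mean q u v M') \<le> coin_mean q u v (\<Union>(C M))"
    proof (rule prod_coin_mean_le_Union[OF assms(1,2)])
      show "finite (C M)" using finQ by (simp add: C_def)
      show "finite M'" if "M' \<in> C M" for M' using CL[OF that] assms(3) finite_subset by blast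
      show "disjoint (C M)"
        using partition_onD2[OF Q'] by (rule pairwise_subset) (auto simp: C_def)
      show "0 \<le> u l \<and> 0 \<le> v l" if "l \<in> \<Union>(C M)" for l
        using that CL nonneg by blast
      show "(\<forall>l\<in>\<Union>(C M). v l \<le> u l) \<or> (\<forall>l\<in>\<Union>(C M). u l \<le> v l)"
        using mono CL by blast
    qed
    then show "(\<Prod>M'\<in>C M. coin_mean q u v M') \<le> coin_mean q u v M"
      using Union[OF M] by simp
  qed
  finally show ?thesis .
qed

section \<open>The elections in which a voter votes\<close>

text \<open>
  The random set of elections in which a voter with turnout probability \<open>q\<close> and poll dates \<open>Q\<close>
  votes. Its values are sets of elections for every \<open>Q\<close>, which puts voters with different
  schedules on the same footing.
\<close>

definition ballot_pmf :: "real \<Rightarrow> 'l set set \<Rightarrow> 'l set pmf" where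
  "ballot_pmf q Q =
     map_pmf (\<lambda>Y. {l. \<exists>M\<in>Q. l \<in> M \<and> Y M}) (Pi_pmf Q False (\<lambda>_. bernoulli_pmf q))"

text \<open>
  The factors of the elections held on one date depend on the same coin, and different dates have
  independent coins, so the integral is a product over dates.
\<close>

lemma nn_integral_ballot_pmf:
  assumes "0 \<le> q" "q \<le> 1" "finite L" and Q: "partition_on L Q"
    and nonneg: "\<And>l. l \<in> L \<Longrightarrow> 0 \<le> u l \<and> 0 \<le> v l"
  shows "(\<integral>\<^sup>+ a. ennreal (\<Prod>l\<in>L. if l \<in> a then u l else v l) \<partial>ballot_pmf q Q) =
    ennreal (\<Prod>M\<in>Q. coin_mean q u v M)"
proof -
  let ?g = "\<lambda>M b. \<Prod>l\<in>M. if b then u l else v l"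
  have finQ: "finite Q" and finM: "\<forall>M\<in>Q. finite M"
    using finite_elements[OF assms(3) Q] assms(3) Q
    by (auto dest!: partition_onD1 intro: finite_subset)
  have disj: "\<forall>M\<in>Q. \<forall>N\<in>Q. M \<noteq> N \<longrightarrow> M \<inter> N = {}"
    using partition_onD2[OF Q] by (auto simp: disjoint_def)
  have g_nonneg: "0 \<le> ?g M b" if "M \<in> Q" for M b
    using that nonneg Q by (intro prod_nonneg) (auto dest!: partition_onD1)
  have split: "(\<Prod>l\<in>L. if l \<in> {l. \<exists>M\<in>Q. l \<in> M \<and> Y M} then u l else v l) = (\<Prod>M\<in>Q. ?g M (Y M))"
    for Y
  proof -
    have "(\<Prod>l\<in>L. if l \<in> {l. \<exists>M\<in>Q. l \<in> M \<and> Y M} then u l else v l) =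
        (\<Prod>M\<in>Q. \<Prod>l\<in>M. if l \<in> {l. \<exists>M\<in>Q. l \<in> M \<and> Y M} then u l else v l)"
      unfolding partition_onD1[OF Q] using finM disj by (simp add: prod.Union_disjoint)
    also have "\<dots> = (\<Prod>M\<in>Q. ?g M (Y M))"
    proof (intro prod.cong refl)
      fix M l assume "M \<in> Q" "l \<in> M"
      then have "N = M" if "N \<in> Q" "l \<in> N" for N
        using disj that by (meson disjoint_iff)
      then have "(\<exists>N\<in>Q. l \<in> N \<and> Y N) = Y M"
        using \<open>M \<in> Q\<close> \<open>l \<in> M\<close> by blast
      then show "(if l \<in> {l. \<exists>M\<in>Q. l \<in> M \<and> Y M} then u l else v l) = (if Y M then u l else v l)"
        by simp
    qed
    finally show ?thesis .
  qed
  have "(\<integral>\<^sup>+ a. ennreal (\<Prod>l\<in>L. if l \<in> a then u l else v l) \<partial>ballot_pmf q Q) =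
      (\<integral>\<^sup>+ Y. (\<Prod>M\<in>Q. ennreal (?g M (Y M))) \<partial>Pi_pmf Q False (\<lambda>_. bernoulli_pmf q))"
    using g_nonneg by (simp add: ballot_pmf_def split prod_ennreal del: mem_Collect_eq)
  also have "\<dots> = (\<Prod>M\<in>Q. \<integral>\<^sup>+ b. ennreal (?g M b) \<partial>bernoulli_pmf q)"
    by (rule nn_integral_prod_Pi_pmf[OF finQ])
  also have "\<dots> = (\<Prod>M\<in>Q. ennreal (coin_mean q u v M))"
  proof (rule prod.cong[OF refl])
    fix M assume "M \<in> Q"
    have "(\<integral>\<^sup>+ b. ennreal (?g M b) \<partial>bernoulli_pmf q) =
        ennreal (?g M True) * ennreal q + ennreal (?g M False) * ennreal (1 - q)"
      using assms(1,2) by (subst nn_integral_bernoulli_pmf) auto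
    also have "\<dots> = ennreal (?g M True * q + ?g M False * (1 - q))"
      using g_nonneg[OF \<open>M \<in> Q\<close>, of True] g_nonneg[OF \<open>M \<in> Q\<close>, of False] assms(1,2)
      by (simp add: ennreal_mult ennreal_plus)
    finally show "(\<integral>\<^sup>+ b. ennreal (?g M b) \<partial>bernoulli_pmf q) = ennreal (coin_mean q u v M)"
      by (simp add: coin_mean_def mult.commute)
  qed
  also have "\<dots> = ennreal (\<Prod>M\<in>Q. coin_mean q u v M)"
    using assms(1,2) nonneg Q
    by (intro prod_ennreal coin_mean_nonneg) (auto dest!: partition_onD1)
  finally show ?thesis .
qed

lemma win_all_prob_eq_nn_integral:
  assumes "finite H" "finite L" and sched: "polling_schedule H L P"
  shows "ennreal (win_all_prob H L p R P s) =
    (\<integral>\<^sup>+ A. ennreal (\<Prod>l\<in>L. win_prob R l s {h \<in> H. l \<in> A h})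
      \<partial>Pi_pmf H {} (\<lambda>h. ballot_pmf (p h) (P h)))"
proof -
  let ?F = "\<lambda>V. \<Prod>l\<in>L. win_prob R l s (V l)"
  let ?coins = "\<lambda>h. Pi_pmf (P h) False (\<lambda>_. bernoulli_pmf (p h))"
  let ?vote = "\<lambda>h Y. {l. \<exists>M\<in>P h. l \<in> M \<and> Y M}"
  have F01: "0 \<le> ?F V" "?F V \<le> 1" for V
    by (auto simp: win_prob_def intro!: prod_nonneg prod_le_1)
  have fin: "finite (P h)" if "h \<in> H" for h
    using sched that assms(2) finite_elements by (auto simp: polling_schedule_def)
  have turnout: "turnout_pmf H p P = map_pmf case_prod (Pi_pmf H (\<lambda>_. False) ?coins)"
    unfolding turnout_pmf_def by (subst Pi_pmf_Sigma) (use assms(1) fin in auto)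
  have ballots: "Pi_pmf H {} (\<lambda>h. ballot_pmf (p h) (P h)) =
      map_pmf (\<lambda>Y h. if h \<in> H then ?vote h (Y h) else {}) (Pi_pmf H (\<lambda>_. False) ?coins)"
    using Pi_pmf_bind[OF assms(1), where d = "{}" and d' = "\<lambda>_. False" and p = ?coins
        and q = "\<lambda>h Y. return_pmf (?vote h Y)"] assms(1)
    by (simp add: ballot_pmf_def map_pmf_def)
  have "integrable (turnout_pmf H p P) (\<lambda>X. ?F (voters_in H P X))"
    using F01 by (intro measure_pmf.integrable_const_bound[where B = 1]) auto
  then have "ennreal (win_all_prob H L p R P s) =
      (\<integral>\<^sup>+ X. ennreal (?F (voters_in H P X)) \<partial>turnout_pmf H p P)"
    using F01 by (simp add: win_all_prob_eq_expectation[OF assms(2)] nn_integral_eq_integral)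
  moreover have "voters_in H P (case_prod Y) l = {h \<in> H. l \<in> (if h \<in> H then ?vote h (Y h) else {})}"
    for Y l
    by (auto simp: voters_in_def)
  ultimately show ?thesis
    by (simp add: turnout ballots)
qed

text \<open>
  Fixing the votes of everybody else, election \<open>l\<close> has two possible win probabilities for \<open>s\<close>,
  with and without the vote of \<open>h\<close>. Whether that vote is for \<open>s\<close> or for a rival, it moves all
  elections in the same direction, so merging the dates of \<open>h\<close> is favourable in both cases.
\<close>

lemma nn_integral_ballot_pmf_coarser:
  assumes "finite L" and mono: "extra_vote_monotone H T L t R" and "s \<in> T" and "h \<in> H"
    and "0 \<le> p h \<and> p h \<le> 1"
    and "polling_schedule H L P" "polling_schedule H L P'" and coarser: "coarser H L P P'"
  shows "(\<integral>\<^sup>+ a. ennreal (\<Prod>l\<in>L. win_prob R l s {k \<in> H. l \<in> (A(h := a)) k}) \<partial>ballot_pmf (p h) (P' h)) \<le>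
    (\<integral>\<^sup>+ a. ennreal (\<Prod>l\<in>L. win_prob R l s {k \<in> H. l \<in> (A(h := a)) k}) \<partial>ballot_pmf (p h) (P h))"
proof -
  define S where "S l = {k \<in> H. k \<noteq> h \<and> l \<in> A k}" for l
  let ?u = "\<lambda>l. win_prob R l s (insert h (S l))" and ?v = "\<lambda>l. win_prob R l s (S l)"
  have P: "partition_on L (P h)" "partition_on L (P' h)"
    using assms(4,6,7) by (auto simp: polling_schedule_def)
  have votes: "{k \<in> H. l \<in> (A(h := a)) k} = (if l \<in> a then insert h (S l) else S l)" for l a
    using \<open>h \<in> H\<close> by (auto simp: S_def)
  have eq: "(\<Prod>l\<in>L. win_prob R l s {k \<in> H. l \<in> (A(h := a)) k}) =
      (\<Prod>l\<in>L. if l \<in> a then ?u l else ?v l)" for a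
    unfolding votes by (intro prod.cong) auto
  have nonneg: "0 \<le> ?u l \<and> 0 \<le> ?v l" for l
    by (simp add: win_prob_def)
  have "S l \<subseteq> H" for l
    by (auto simp: S_def)
  then have dir: "(\<forall>l\<in>L. ?v l \<le> ?u l) \<or> (\<forall>l\<in>L. ?u l \<le> ?v l)"
    using mono \<open>s \<in> T\<close> \<open>h \<in> H\<close> unfolding extra_vote_monotone_def by (cases "s = t h") blast+
  have refine: "\<exists>M\<in>P h. M' \<subseteq> M" if M': "M' \<in> P' h" for M'
  proof -
    have "M' \<noteq> {}" "M' \<subseteq> L"
      using M' partition_onD3[OF P(2)] partition_onD1[OF P(2)] by auto
    then obtain l where l: "l \<in> M'" "l \<in> L" by auto
    then obtain M where M: "M \<in> P h" "l \<in> M"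
      using partition_onD1[OF P(1)] by auto
    have "l' \<in> M" if "l' \<in> M'" for l'
    proof -
      have "simultaneous P' h l l'" using that M' l by (auto simp: simultaneous_def)
      then have "simultaneous P h l l'"
        using coarser \<open>h \<in> H\<close> l that \<open>M' \<subseteq> L\<close> by (auto simp: coarser_def)
      then obtain N where "N \<in> P h" "l \<in> N" "l' \<in> N" by (auto simp: simultaneous_def)
      then show ?thesis
        using M partition_onD2[OF P(1)] by (auto simp: disjoint_def)
    qed
    then show ?thesis using M by auto
  qed
  have "(\<Prod>M\<in>P' h. coin_mean (p h) ?u ?v M) \<le> (\<Prod>M\<in>P h. coin_mean (p h) ?u ?v M)"
    using assms(1,5) P refine nonneg dir by (intro prod_coin_mean_mono_coarser) auto
  then show ?thesis
    using assms(1,5) P nonneg by (simp only: eq) (simp add: nn_integral_ballot_pmf ennreal_leI)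
qed

theorem mainTheorem4:
  fixes H :: "'h set" and T :: "'t set" and L :: "'l set"
    and p :: "'h \<Rightarrow> real" and t :: "'h \<Rightarrow> 't"
    and R :: "'l \<Rightarrow> 'h set \<Rightarrow> 't set pmf"
    and P P' :: "'h \<Rightarrow> 'l set set"
  assumes "finite H" and "finite T" and "finite L" and "L \<noteq> {}"
    and "\<And>h. h \<in> H \<Longrightarrow> 0 \<le> p h \<and> p h \<le> 1"
    and "\<And>h. h \<in> H \<Longrightarrow> t h \<in> T"
    and "at_most_one_winner H T L R"
    and "extra_vote_monotone H T L t R"
    and "polling_schedule H L P" and "polling_schedule H L P'"
    and "coarser H L P P'"
  shows "\<forall>s\<in>T. win_all_prob H L p R P s \<ge> win_all_prob H L p R P' s"
proof
  fix s assume "s \<in> T"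
  have "ennreal (win_all_prob H L p R P' s) \<le> ennreal (win_all_prob H L p R P s)"
    unfolding win_all_prob_eq_nn_integral[OF assms(1,3,9)]
      win_all_prob_eq_nn_integral[OF assms(1,3,10)]
    using assms \<open>s \<in> T\<close>
    by (intro nn_integral_Pi_pmf_mono nn_integral_ballot_pmf_coarser) auto
  then show "win_all_prob H L p R P s \<ge> win_all_prob H L p R P' s"
    by (simp add: win_all_prob_def)
qed

end
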